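(* There is no function $\psi:T\to\mathbb{C}$ such that $M_\psi$ is an isometry from $\mathcal{L}_{\mathbf{w}}$ to $\mathcal{L}$, and there is no function $\psi:T\to\mathbb{C}$ such that $M_\psi$ is an isometry from $\mathcal{L}_{\mathbf{w},0}$ to $\mathcal{L}_0$.
   Context: $T$ is the vertex set of a tree (a locally finite, connected, simply connected graph), rooted at a vertex $o$ and without terminal vertices (a terminal vertex is one having a unique neighbor), hence infinite. $|v|$ is the number of edges in the path from $o$ to $v$; $T^*=T\setminus\{o\}$; for $v\in T^*$, $v^-$ is the neighbor of $v$ closest to $o$. For $f:T\to\mathbb{C}$ and $v\in T^*$, $Df(v)=|f(v)-f(v^-)|$. The Lipschitz space $\mathcal{L}$ is the Banach space of all $f:T\to\mathbb{C}$ with $\sup_{v\in T^*}Df(v)<\infty$, with norm $\|f\|_{\mathcal{L}}=|f(o)|+\sup_{v\in T^*}Df(v)$; the little Lipschitz space is the closed subspace $\mathcal{L}_0=\{f\in\mathcal{L}:\lim_{|v|\to\infty}Df(v)=0\}$. The weighted Lipschitz space $\mathcal{L}_{\mathbf{w}}$ is the Banach space of all $f:T\to\mathbb{C}$ with $\sup_{v\in T^*}|v|Df(v)<\infty$, with norm $\|f\|_{\mathbf{w}}=|f(o)|+\sup_{v\in T^*}|v|Df(v)$; the little weighted Lipschitz space is the closed subspace $\mathcal{L}_{\mathbf{w},0}=\{f\in\mathcal{L}_{\mathbf{w}}:\lim_{|v|\to\infty}|v|Df(v)=0\}$. For $\psi:T\to\mathbb{C}$, $M_\psi f=\psi f$ (pointwise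 product). $M_\psi$ is an isometry from $X$ to $Y$ if $\psi f\in Y$ and $\|\psi f\|_Y=\|f\|_X$ for all $f\in X$. *)

theory Defs
  imports Complex_Main "HOL-Library.FuncSet" "Graph_Theory.Digraph_Component"
begin

text \<open>
  Undirected simple graphs, possibly infinite, are symmetric loop-free pair digraphs.  In such
  a digraph every edge yields a closed arc walk \<open>u, v, u\<close>, which counts as a \<open>cycle\<close> (so the library
  predicates \<open>forest\<close> and \<open>tree\<close> are of no use here); the cycles of the undirected graph are those
  of length at least 3.

  \<open>infinite_tree\<close> only serves to exclude the one-vertex tree, which has no terminal vertex either;
  any other tree without terminal vertices is infinite.
\<close>

locale rooted_tree = pair_bidirected_digraph G for G :: "'a pair_pre_digraph" +
  fixes rt :: 'a
  assumes root_in_tree: "rt \<in> verts G"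
    and connected_tree: "Digraph_Component.connected G"
    and acyclic_tree: "\<not> (\<exists>p. cycle p \<and> length p \<ge> 3)"
    and locally_finite: "v \<in> verts G \<Longrightarrow> finite {w. v \<rightarrow>\<^bsub>G\<^esub> w}"
    and no_terminal: "v \<in> verts G \<Longrightarrow> \<not> (\<exists>!w. v \<rightarrow>\<^bsub>G\<^esub> w)"
    and infinite_tree: "infinite (verts G)"
begin

definition level :: "'a \<Rightarrow> nat" where
  "level v = length (THE p. apath rt p v)"

definition parent :: "'a \<Rightarrow> 'a" where
  "parent v = (ARG_MIN level u. v \<rightarrow>\<^bsub>G\<^esub> u)"

definition nonroot :: "'a set" where
  "nonroot = verts G - {rt}"

definition D :: "('a \<Rightarrow> complex) \<Rightarrow> 'a \<Rightarrow> real" where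
  "D f v = cmod (f v - f (parent v))"

text \<open>The filter of the limits \<open>\<bar>v\<bar> \<rightarrow> \<infinity>\<close> with \<open>v\<close> ranging over the vertices other than the root.\<close>

definition at_infinite_level :: "'a filter" where
  "at_infinite_level = inf (filtercomap level at_top) (principal nonroot)"

text \<open>
  Functions on the vertex set are represented as extensional functions, so that
  they are determined by their values on the vertices.
\<close>

definition lipschitz :: "('a \<Rightarrow> complex) set" where
  "lipschitz = {f \<in> verts G \<rightarrow>\<^sub>E UNIV. bdd_above (D f ` nonroot)}"

definition lipschitz_norm :: "('a \<Rightarrow> complex) \<Rightarrow> real" where
  "lipschitz_norm f = cmod (f rt) + (SUP v\<in>nonroot. D f v)"

definition little_lipschitz :: "('a \<Rightarrow> complex) set" where
  "little_lipschitz = {f \<in> lipschitz. (D f \<longlongrightarrow> 0) at_infinite_level}"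

definition weighted_lipschitz :: "('a \<Rightarrow> complex) set" where
  "weighted_lipschitz =
    {f \<in> verts G \<rightarrow>\<^sub>E UNIV. bdd_above ((\<lambda>v. real (level v) * D f v) ` nonroot)}"

definition weighted_norm :: "('a \<Rightarrow> complex) \<Rightarrow> real" where
  "weighted_norm f = cmod (f rt) + (SUP v\<in>nonroot. real (level v) * D f v)"

definition little_weighted_lipschitz :: "('a \<Rightarrow> complex) set" where
  "little_weighted_lipschitz =
    {f \<in> weighted_lipschitz. ((\<lambda>v. real (level v) * D f v) \<longlongrightarrow> 0) at_infinite_level}"

definition mult_op :: "('a \<Rightarrow> complex) \<Rightarrow> ('a \<Rightarrow> complex) \<Rightarrow> 'a \<Rightarrow> complex" where
  "mult_op \<psi> f = (\<lambda>v\<in>verts G. \<psi> v * f v)"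

end

definition isometry_between ::
  "'f set \<Rightarrow> ('f \<Rightarrow> real) \<Rightarrow> 'g set \<Rightarrow> ('g \<Rightarrow> real) \<Rightarrow> ('f \<Rightarrow> 'g) \<Rightarrow> bool" where
  "isometry_between X norm_X Y norm_Y M \<longleftrightarrow> (\<forall>f\<in>X. M f \<in> Y \<and> norm_Y (M f) = norm_X f)"

end

theory Submission
  imports Defs
begin

text \<open>
  The constant function 1 has weighted norm 1, so \<open>cmod (\<psi> rt) + (SUP v\<in>nonroot. D \<psi> v) \<le> 1\<close>, and hence
  \<open>cmod (\<psi> v) \<le> 1\<close> at every child \<open>v\<close> of the root.  The indicator function of \<open>v\<close> has weighted
  norm at least 2, the level of a child of \<open>v\<close>, but its product with \<open>\<psi>\<close> has Lipschitz norm
  at most \<open>cmod (\<psi> v)\<close>.  Both test functions lie in the little weighted space.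
\<close>

context rooted_tree
begin

text \<open>
  If two paths from \<open>a\<close> leave through different neighbours \<open>x\<close> and \<open>y\<close>, then a path from \<open>x\<close>
  to \<open>y\<close> avoiding \<open>a\<close> closes up to a cycle through \<open>a\<close>.
\<close>

lemma apath_unique:
  assumes "apath a p b" "apath a q b"
  shows "p = q"
  using assms
proof (induction p arbitrary: a q)
  case Nil
  then have "a = b" by (simp add: apath_Nil_iff)
  with Nil.prems(2) show ?case
    using apath_nonempty_ends by blast
next
  case (Cons e p)
  obtain x where e: "e = (a, x)" and ax: "(a, x) \<in> parcs G"
    and px: "apath x p b" and ap: "a \<notin> set (awalk_verts x p)"
    using Cons.prems(1) by (cases e) (auto simp: apath_Cons_iff)
  have "a \<noteq> b" using apath_nonempty_ends[OF Cons.prems(1)] by simp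
  with Cons.prems(2) obtain e' q' where q: "q = e' # q'"
    by (cases q) (auto simp: apath_Nil_iff)
  obtain y where e': "e' = (a, y)" and ay: "(a, y) \<in> parcs G"
    and qy: "apath y q' b" and aq: "a \<notin> set (awalk_verts y q')"
    using Cons.prems(2) unfolding q by (cases e') (auto simp: apath_Cons_iff)
  have "x = y"
  proof (rule ccontr)
    assume "x \<noteq> y"
    have px': "awalk x p b" and qy': "awalk b (rev_path q') y"
      using px qy by (auto intro: awalkI_apath)
    define r where "r = p @ rev_path q'"
    have r: "awalk x r y"
      unfolding r_def using px' qy' by (rule awalk_appendI)
    \<comment> \<open>Avoidance of \<open>a\<close> is recorded on arcs, since shortening
      \<open>r\<close> to the path \<open>s\<close> is controlled through
      \<open>set s \<subseteq> set r\<close>.\<close>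
    have ar: "\<forall>c\<in>set r. fst c \<noteq> a \<and> snd c \<noteq> a"
    proof -
      have "a \<notin> set (awalk_verts b (rev_path q'))"
        using aq qy awalk_verts_rev_path[of y q' b] by (simp add: awalkI_apath)
      then have "\<forall>c\<in>set (rev_path q'). fst c \<noteq> a \<and> snd c \<noteq> a"
        using awalk_verts_arc1[of _ "rev_path q'" b] awalk_verts_arc2[OF qy'] by auto
      moreover have "\<forall>c\<in>set p. fst c \<noteq> a \<and> snd c \<noteq> a"
        using awalk_verts_arc1[of _ p x] awalk_verts_arc2[OF px'] ap by auto
      ultimately show ?thesis unfolding r_def by auto
    qed
    define s where "s = awalk_to_apath r"
    have s: "apath x s y"
      unfolding s_def using r by (rule apath_awalk_to_apath)
    have "set s \<subseteq> set r"
      unfolding s_def using r by (rule awalk_to_apath_subset)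
    have "s \<noteq> []" using s \<open>x \<noteq> y\<close> by (auto simp: apath_Nil_iff)
    then have "last s \<in> set r" using \<open>set s \<subseteq> set r\<close> by auto
    then have as: "a \<notin> set (awalk_verts x s)"
      using \<open>set s \<subseteq> set r\<close> ar \<open>s \<noteq> []\<close> by (auto simp: awalk_verts_conv)
    have ya: "(y, a) \<in> parcs G" using ay by (rule arcs_symmetric)
    have sa: "awalk x s y" using s by (rule awalkI_apath)
    have "y \<in> verts G" "a \<in> verts G" using ya by (auto dest: in_arcsD1 in_arcsD2)
    then have w: "awalk x (s @ [(y, a)]) a"
      using sa ya by (auto simp: awalk_simps)
    have "awalk_verts x (s @ [(y, a)]) = awalk_verts x s @ [a]"
      using w by (subst awalk_verts_append) auto
    \<comment> \<open>\<open>cycle\<close> asks for distinct vertices after the starting one;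
      without its initial \<open>a\<close>, the closed walk visits exactly this list.\<close>
    then have "distinct (awalk_verts x (s @ [(y, a)]))"
      using as s by (auto simp: apath_def)
    then have "cycle ((a, x) # s @ [(y, a)])"
      unfolding cycle_def using w ax by (intro exI[of _ a]) (auto simp: awalk_Cons_iff)
    \<comment> \<open>Since \<open>x \<noteq> y\<close>, \<open>s\<close> is nonempty; this
      separates the cycle from a walk along an edge and back.\<close>
    moreover have "length ((a, x) # s @ [(y, a)]) \<ge> 3"
      using \<open>s \<noteq> []\<close> by (cases s) auto
    ultimately show False using acyclic_tree by blast
  qed
  then show ?case
    using Cons.IH[OF px, of q'] qy by (simp add: q e e')
qed

text \<open>Uniqueness of paths resolves the definite description in \<open>level\<close>, so
  exhibiting any path computes the level.\<close>

lemma level_eq_length: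
  assumes "apath rt p v"
  shows "level v = length p"
  unfolding level_def using assms apath_unique by (metis the_equality)

lemma apath_from_root:
  assumes "v \<in> verts G"
  obtains p where "apath rt p v"
proof -
  have "rt \<rightarrow>\<^sup>*\<^bsub>mk_symmetric G\<^esub> v"
    using connected_tree root_in_tree assms
    unfolding Digraph_Component.connected_def by (auto elim: strongly_connectedE)
  \<comment> \<open>Connectedness is defined through the symmetric closure, which has the same
    reachability as the symmetric digraph \<open>G\<close>.\<close>
  then have "rt \<rightarrow>\<^sup>*\<^bsub>G\<^esub> v"
    using reachable_mk_symmetric_eq[OF sym_arcs] by simp
  then show ?thesis using that reachable_apath by blast
qed

lemma level_root [simp]: "level rt = 0"
  using level_eq_length[of "[]"] root_in_tree by (simp add: apath_Nil_iff)

lemma level_eq_0_iff: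
  assumes "v \<in> verts G"
  shows "level v = 0 \<longleftrightarrow> v = rt"
  using assms by (metis apath_from_root apath_Nil_iff length_0_conv level_eq_length level_root)

lemma level_eq_1_iff:
  assumes "v \<in> verts G"
  shows "level v = 1 \<longleftrightarrow> rt \<rightarrow>\<^bsub>G\<^esub> v"
proof
  assume "level v = 1"
  obtain p where p: "apath rt p v" using apath_from_root[OF assms] .
  with \<open>level v = 1\<close> have "length p = 1" by (simp add: level_eq_length)
  then obtain e where "p = [e]" by (auto simp: length_Suc_conv)
  with p show "rt \<rightarrow>\<^bsub>G\<^esub> v" by (cases e) (auto simp: apath_simps)
next
  assume arc: "rt \<rightarrow>\<^bsub>G\<^esub> v"
  then have "apath rt [(rt, v)] v"
    using assms no_loops'[of rt v] by (auto simp: apath_simps)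
  then show "level v = 1" using level_eq_length by fastforce
qed

text \<open>\<open>no_terminal\<close> excludes exactly one neighbour, but not zero. A path between
  the root and another vertex has an arc at each end, and infinity provides such a vertex for the
  root.\<close>

lemma adjacent_exists:
  assumes "v \<in> verts G"
  obtains w where "v \<rightarrow>\<^bsub>G\<^esub> w"
proof -
  have "\<exists>w. rt \<rightarrow>\<^bsub>G\<^esub> w"
  proof -
    have "verts G \<noteq> {rt}" using infinite_tree by auto
    then obtain u where u: "u \<in> verts G" "u \<noteq> rt" using root_in_tree by blast
    obtain p where "apath rt p u" using apath_from_root[OF u(1)] .
    with u(2) show ?thesis
      by (cases p) (auto simp: apath_simps)
  qed
  moreover have "\<exists>w. v \<rightarrow>\<^bsub>G\<^esub> w" if "v \<noteq> rt"
  proof -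
    obtain p where p: "apath rt p v" using apath_from_root[OF assms] .
    then have "apath v (rev_path p) rt" by simp
    with that show ?thesis
      by (cases "rev_path p") (auto simp: apath_simps)
  qed
  ultimately show ?thesis using that by blast
qed

lemma parent_adjacent:
  assumes "v \<in> verts G"
  shows "v \<rightarrow>\<^bsub>G\<^esub> parent v"
proof -
  obtain w where "v \<rightarrow>\<^bsub>G\<^esub> w" using adjacent_exists[OF assms] .
  then show ?thesis unfolding parent_def by (rule arg_min_natI)
qed

lemma parent_in_verts:
  assumes "v \<in> verts G"
  shows "parent v \<in> verts G"
  using parent_adjacent[OF assms] by (auto dest: in_arcsD2)

lemma level_parent_le:
  assumes "v \<rightarrow>\<^bsub>G\<^esub> u"
  shows "level (parent v) \<le> level u"
  unfolding parent_def using assms by (rule arg_min_nat_le)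

text \<open>Provides the vertex carrying the indicator function, \<open>parent w\<close>, together
  with a child \<open>w\<close> whose weight 2 exceeds the bound 1 on \<open>\<psi>\<close>.\<close>

lemma grandchild_of_root:
  obtains w where "w \<in> nonroot" "level w = 2" "parent w \<in> nonroot" "parent (parent w) = rt"
proof -
  obtain v where v: "rt \<rightarrow>\<^bsub>G\<^esub> v" using adjacent_exists[OF root_in_tree] .
  then have vV: "v \<in> verts G" and vr: "v \<rightarrow>\<^bsub>G\<^esub> rt" and "v \<noteq> rt"
    using no_loops'[of rt v] by (auto dest: in_arcsD2 arcs_symmetric)
  obtain w where w: "v \<rightarrow>\<^bsub>G\<^esub> w" "w \<noteq> rt"
    using no_terminal[OF vV] vr by blast
  then have wV: "w \<in> verts G" and wv: "w \<rightarrow>\<^bsub>G\<^esub> v" and "v \<noteq> w"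
    using no_loops'[of v w] by (auto dest: in_arcsD2 arcs_symmetric)
  have "apath rt [(rt, v), (v, w)] w"
    using v w vV wV \<open>v \<noteq> w\<close> \<open>v \<noteq> rt\<close> by (auto simp: apath_simps)
  then have lw: "level w = 2" using level_eq_length by fastforce
  \<comment> \<open>There is no need to identify \<open>u\<close> with \<open>v\<close>: a neighbour
    of \<open>w\<close> that has level at most 1 and is not the root serves equally well.\<close>
  define u where "u = parent w"
  have uV: "u \<in> verts G" and wu: "w \<rightarrow>\<^bsub>G\<^esub> u"
    unfolding u_def using parent_adjacent[OF wV] parent_in_verts[OF wV] by auto
  have "level u \<le> 1"
    unfolding u_def using level_parent_le[OF wv] level_eq_1_iff[OF vV] v by simp
  have "u \<noteq> rt"
  proof
    assume "u = rt"
    then have "rt \<rightarrow>\<^bsub>G\<^esub> w" using wu by (auto intro: arcs_symmetric)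
    then have "level w = 1" using level_eq_1_iff[OF wV] by blast
    with lw show False by simp
  qed
  then have "level u = 1"
    using \<open>level u \<le> 1\<close> level_eq_0_iff[OF uV] by linarith
  then have "rt \<rightarrow>\<^bsub>G\<^esub> u" using level_eq_1_iff[OF uV] by blast
  then have "u \<rightarrow>\<^bsub>G\<^esub> rt" by (auto intro: arcs_symmetric)
  then have "parent u = rt"
    using level_parent_le[of u rt] level_eq_0_iff[OF parent_in_verts[OF uV]] by simp
  then show ?thesis
    using that[of w] lw w wV uV \<open>u \<noteq> rt\<close> unfolding u_def nonroot_def by auto
qed

text \<open>The weighted differences take finitely many values, hence are bounded, and vanish beyond
  the highest level in the finite set.\<close>

lemma little_weighted_lipschitzI:
  assumes ext: "f \<in> verts G \<rightarrow>\<^sub>E UNIV" and fin: "finite {v \<in> nonroot. D f v \<noteq> 0}" (is "finite ?S")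
  shows "f \<in> little_weighted_lipschitz"
proof -
  let ?g = "\<lambda>v. real (level v) * D f v"
  have "?g ` nonroot \<subseteq> insert 0 (?g ` ?S)" by auto
  then have "bdd_above (?g ` nonroot)"
    using fin by (meson bdd_above_finite bdd_above_mono finite.insertI finite_imageI)
  moreover have "\<forall>\<^sub>F v in at_infinite_level. ?g v = 0"
  proof -
    obtain N where N: "\<forall>v\<in>?S. level v < N"
      using finite_nat_set_iff_bounded[of "level ` ?S"] fin by auto
    have "\<forall>\<^sub>F v in filtercomap level at_top. N \<le> level v"
      using filterlim_filtercomap[of level at_top] by (simp add: filterlim_at_top)
    then show ?thesis
      unfolding at_infinite_level_def eventually_inf_principal
    proof (rule eventually_mono)
      fix v assume "N \<le> level v"
      with N show "v \<in> nonroot \<longrightarrow> ?g v = 0" by force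
    qed
  qed
  then have "(?g \<longlongrightarrow> 0) at_infinite_level" by (rule tendsto_eventually)
  ultimately show ?thesis
    using ext unfolding little_weighted_lipschitz_def weighted_lipschitz_def by auto
qed

text \<open>Leaving \<open>X\<close> and \<open>Y\<close> open covers both claims at once: the test
  functions lie in the smaller domain, and only membership in the larger target is used.\<close>

lemma no_isometry:
  assumes iso: "isometry_between X weighted_norm Y lipschitz_norm (mult_op \<psi>)"
    and X: "little_weighted_lipschitz \<subseteq> X" and Y: "Y \<subseteq> lipschitz"
  shows False
proof -
  have iso': "mult_op \<psi> f \<in> lipschitz" "lipschitz_norm (mult_op \<psi> f) = weighted_norm f"
    if "f \<in> little_weighted_lipschitz" for f
    using that iso X Y unfolding isometry_between_def by auto
  obtain w where w: "w \<in> nonroot" "level w = 2" and vn: "parent w \<in> nonroot"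
    and vr: "parent (parent w) = rt"
    using grandchild_of_root .
  define v where "v = parent w"
  have vV: "v \<in> verts G" and vnr: "v \<noteq> rt" using vn by (auto simp: v_def nonroot_def)
  have wV: "w \<in> verts G" using w by (simp add: nonroot_def)
  have wv: "w \<noteq> v"
    using parent_adjacent[OF wV] no_loops'[of w v] by (auto simp: v_def)
  have nonroot: "u \<in> verts G" "parent u \<in> verts G" if "u \<in> nonroot" for u
    using that parent_in_verts by (auto simp: nonroot_def)

  define \<iota> where "\<iota> = (\<lambda>u\<in>verts G. 1 :: complex)"
  have D\<iota>: "D \<iota> u = 0" if "u \<in> nonroot" for u
    using nonroot[OF that] by (simp add: D_def \<iota>_def)
  then have "{u \<in> nonroot. D \<iota> u \<noteq> 0} = {}" by auto
  then have "finite {u \<in> nonroot. D \<iota> u \<noteq> 0}" by (simp only: finite.emptyI)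
  then have \<iota>: "\<iota> \<in> little_weighted_lipschitz"
    by (intro little_weighted_lipschitzI) (auto simp: \<iota>_def)
  have "(SUP u\<in>nonroot. real (level u) * D \<iota> u) = (SUP u\<in>nonroot. 0)"
    by (intro SUP_cong) (auto simp: D\<iota>)
  \<comment> \<open>The supremum of a constant is that constant only over a nonempty set;
    \<open>w\<close> witnesses this.\<close>
  also have "\<dots> = 0" using w(1) by (subst cSUP_const) auto
  finally have norm\<iota>: "weighted_norm \<iota> = 1"
    using root_in_tree by (simp add: weighted_norm_def \<iota>_def)
  have "D (mult_op \<psi> \<iota>) v \<le> (SUP u\<in>nonroot. D (mult_op \<psi> \<iota>) u)"
    using iso'(1)[OF \<iota>] vn unfolding v_def lipschitz_def by (intro cSUP_upper) auto
  then have "cmod (\<psi> rt) + cmod (\<psi> v - \<psi> rt) \<le> 1"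
    using iso'(2)[OF \<iota>] norm\<iota> root_in_tree vV vr
    by (simp add: lipschitz_norm_def D_def mult_op_def \<iota>_def v_def)
  then have \<psi>v: "cmod (\<psi> v) \<le> 1"
    using norm_triangle_sub[of "\<psi> v" "\<psi> rt"] by linarith

  define \<chi> where "\<chi> = (\<lambda>u\<in>verts G. if u = v then 1 else 0 :: complex)"
  \<comment> \<open>A nonzero difference at \<open>u\<close> forces \<open>u = v\<close> or
    \<open>parent u = v\<close>, so local finiteness bounds the number of such
    \<open>u\<close>.\<close>
  have "u = v \<or> v \<rightarrow>\<^bsub>G\<^esub> u" if "u \<in> nonroot" "D \<chi> u \<noteq> 0" for u
    using that nonroot[of u] parent_adjacent[of u]
    by (auto simp: D_def \<chi>_def split: if_splits intro: arcs_symmetric)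
  then have "{u \<in> nonroot. D \<chi> u \<noteq> 0} \<subseteq> insert v {u. v \<rightarrow>\<^bsub>G\<^esub> u}" by blast
  then have "finite {u \<in> nonroot. D \<chi> u \<noteq> 0}"
    using locally_finite[OF vV] by (meson finite.insertI finite_subset)
  then have \<chi>: "\<chi> \<in> little_weighted_lipschitz"
    by (intro little_weighted_lipschitzI) (auto simp: \<chi>_def)
  have "2 = real (level w) * D \<chi> w"
    using w wV vV wv by (simp add: D_def \<chi>_def v_def)
  also have "\<dots> \<le> (SUP u\<in>nonroot. real (level u) * D \<chi> u)"
    using \<chi> w unfolding little_weighted_lipschitz_def weighted_lipschitz_def
    by (intro cSUP_upper) auto
  also have "\<dots> \<le> weighted_norm \<chi>" by (simp add: weighted_norm_def)
  also have "\<dots> = lipschitz_norm (mult_op \<psi> \<chi>)" using iso'(2)[OF \<chi>] by simp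
  \<comment> \<open>The root term vanishes because \<open>v\<close> is not the root.\<close>
  also have "\<dots> = (SUP u\<in>nonroot. D (mult_op \<psi> \<chi>) u)"
    using root_in_tree vnr by (simp add: lipschitz_norm_def mult_op_def \<chi>_def)
  \<comment> \<open>The product is \<open>\<psi> v\<close> at \<open>v\<close> and 0 at all other
    vertices, so each difference is 0 or \<open>cmod (\<psi> v)\<close>; no level enters on this
    side.\<close>
  also have "\<dots> \<le> cmod (\<psi> v)"
    using w nonroot by (intro cSUP_least) (auto simp: D_def mult_op_def \<chi>_def)
  finally show False using \<psi>v by simp
qed

end

theorem theorem2p2:
  fixes G :: "'a pair_pre_digraph" and rt :: 'a
  assumes "rooted_tree G rt"
  shows "\<not> (\<exists>\<psi> :: 'a \<Rightarrow> complex. isometry_between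
              (rooted_tree.weighted_lipschitz G rt) (rooted_tree.weighted_norm G rt)
              (rooted_tree.lipschitz G rt) (rooted_tree.lipschitz_norm G rt)
              (rooted_tree.mult_op G \<psi>))
       \<and> \<not> (\<exists>\<psi> :: 'a \<Rightarrow> complex. isometry_between
              (rooted_tree.little_weighted_lipschitz G rt) (rooted_tree.weighted_norm G rt)
              (rooted_tree.little_lipschitz G rt) (rooted_tree.lipschitz_norm G rt)
              (rooted_tree.mult_op G \<psi>))"
proof -
  interpret rooted_tree G rt by fact
  have "little_weighted_lipschitz \<subseteq> weighted_lipschitz" "little_lipschitz \<subseteq> lipschitz"
    by (auto simp: little_weighted_lipschitz_def little_lipschitz_def)
  then show ?thesis using no_isometry by blast
qed

end
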